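(* Let $(\dot z,\dot x)\in\overline{\mathcal P}$ be such that $0\le\dot z\le\overline z$ and $0\le\dot x\le\overline x$. Let $(\tilde y,\tilde w,\tilde\pi,\tilde\mu^y,\tilde\mu^w,\tilde\theta^y_{\leftrightarrow},\tilde\theta^w_{\leftrightarrow})$ be a nonzero nonnegative vector satisfying $\tilde y_{\leftrightarrow}=0$, $\tilde w_{\leftrightarrow}=0$ and $$\begin{pmatrix} G_\infty & H_\infty & 0&0&0&0&0\\ \mathcal R_\infty&0&G^\top&-I^y&0&I^y_{\leftrightarrow}&0\\ 0&0&H^\top&0&-I^w&0&I^w_{\leftrightarrow} \end{pmatrix} \begin{pmatrix} \tilde y_\infty \\ \tilde w_\infty \\ \tilde\pi \\ \tilde\mu^y \\ \tilde\mu^w \\ \tilde\theta^y_{\leftrightarrow} \\ \tilde\theta^w_{\leftrightarrow} \end{pmatrix}=0 ,$$ i.e. this vector is a ray corresponding to the constraints (F) below together with $\pi\ge0$. If $\tilde\pi_0^\top\dot x>0$, then $\vartheta_{\mathrm{KKT}}^{\mathrm{relax}}=\infty$, i.e. the relaxation $$\begin{aligned} \vartheta_{\mathrm{KKT}}^{\mathrm{relax}}=\max\ &\pi_0^\top x-c_x^\top x-c_z^\top z\\ \text{s.t. }&(z,x)\in\overline{\mathcal P},\ 0\le z\le\overline z,\ 0\le x\le\overline x,\ \pi\ge0,\ \text{and the constraints (F):}\\ &Gy+Hw=h+\begin{pmatrix} x \\ 0 \end{pmatrix},\ \ \mathcal Ry+G^\top\pi-\mu^y+I^y_{\leftrightarrow}\theta^y_{\leftrightarrow}=-r,\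 \ H^\top\pi-\mu^w+I^w_{\leftrightarrow}\theta^w_{\leftrightarrow}=0,\\ &y\ge0,\ w\ge0,\ y_{\leftrightarrow}\le\overline y_{\leftrightarrow},\ w_{\leftrightarrow}\le\overline w_{\leftrightarrow},\ \mu\ge0,\ \theta^y_{\leftrightarrow}\ge0,\ \theta^w_{\leftrightarrow}\ge0 \end{aligned}$$ (maximization over $z,x,y,w,\pi,\mu=(\mu^y,\mu^w),\theta^y_{\leftrightarrow},\theta^w_{\leftrightarrow}$) is unbounded.
   Context: Leader problem. $\overline{\mathcal P}\subseteq\mathbb R^{d_z+d_x}$ is a closed convex set; $\mathcal P=\overline{\mathcal P}\cap(\mathcal Z\times\mathcal X)$, where $\mathcal Z\subseteq\mathbb R^{d_z}$ and $\mathcal X\subseteq\mathbb R^{d_x}$ impose integrality on some of the components of $z$ and $x$; $\overline z,\overline x$ are finite upper bounds; $c_z,c_x$ are given cost vectors. The leader maximizes $\pi_0^\top x-c_x^\top x-c_z^\top z$ subject to $(z,x)\in\mathcal P$, $0\le z\le\overline z$, $0\le x\le\overline x$ and $\pi=(\pi_0,\pi_1)\ge0$, where $\pi$ is the equilibrium price vector, a dual solution for the equality constraints of the follower problem at $x$. Follower problem. For given $x$, $\mathcal Y(x)$ is the set of $(y,w)\in\mathbb R^{d_y+d_w}$ with $G_0y+H_0w-x=h_0$ (dual variable $\pi_0$), $G_1y+H_1w=h_1$ (dual variable $\pi_1$), $0\le y\le\overline y$, $0\le w\le\overline w$, where components of $\overline y,\overline w$ may be $+\infty$. Write $G=\begin{pmatrix}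 G_0 \\ G_1 \end{pmatrix}$, $H=\begin{pmatrix} H_0 \\ H_1 \end{pmatrix}$, $h=\begin{pmatrix} h_0 \\ h_1 \end{pmatrix}$. The follower cost vector is affine, $\Phi(y)=\mathcal Ry+r$, with $\mathcal R$ a symmetric positive definite matrix. The follower seeks $(y^*,w^* )\in\mathcal Y(x)$ such that $\langle\Phi(y^* ),y'-y^*\rangle\ge0$ for all $y'$ in the projection of $\mathcal Y(x)$ onto the $y$-space; equivalently, the follower solves $\min_{(y,w)\in\mathcal Y(x)}\frac12y^\top\mathcal Ry+r^\top y$. The variables $\mu^y,\mu^w$ are the dual variables of $y\ge0$, $w\ge0$, and $\theta^y,\theta^w$ those of $y\le\overline y$, $w\le\overline w$ (those attached to infinite bounds are zero and omitted). The relaxation in the claim is obtained from the single-level reformulation of the leader problem by the follower's KKT conditions, by dropping the complementarity constraints and the integrality requirements. Standing assumption: for any feasible solution $x$ to the leader, the solution set of the follower problem at $x$ is non-empty. Notation. $I^y,I^w$ are the identity matrices of dimensions $d_y,d_w$. For a matrix $M$ with $d_y$ columns (such as $G,\mathcal R,I^y$), $M_\infty$ (resp. $M_{\leftrightarrow}$) is the submatrix of the columns whose indices belong (resp. do not belong) to $\{i:\overline y_i=\infty\}$; for matrices with $d_w$ columns (such as $H,I^w$) the same is done with $\{i:\overline w_i=\infty\}$. Vectors in $\mathbb R^{d_y}$ or $\mathbb R^{d_w}$ are partitioned similarly into subvectors $v_\infty$ and $v_{\leftrightarrow}$. The block $\tilde\pi_0$ of $\tilde\pi=(\tilde\pi_0,\tilde\pi_1)$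 is the one corresponding to $\pi_0$.
   Formalization: Added hypothesis: if constraints (F) at ẋ are satisfiable for some π, they are satisfiable with some π ≥ 0; without it the claim is false. The standing assumption (follower solution set non-empty) is required at ẋ itself, even if ẋ is not integral. *)

theory Defs
  imports "HOL-Analysis.Analysis"
begin

text \<open>Block vectors and matrices. As a matrix of type \<open>real^'n^'m\<close> is a vector of
  rows, \<open>vstack\<close> serves both for stacking vectors and for stacking matrices.\<close>

definition vstack :: "'a^'p \<Rightarrow> 'a^'q \<Rightarrow> 'a^('p + 'q)" where
  "vstack u v = (\<chi> k. case k of Inl i \<Rightarrow> u $ i | Inr j \<Rightarrow> v $ j)"

text \<open>Submatrices of selected columns, and the corresponding subvectors, are represented by
  padding with zeros: the product \<open>cols S M *v subvec S v\<close> is the product of the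
  submatrix of the columns in \<open>S\<close> with the subvector of the components in \<open>S\<close>.\<close>

definition cols :: "'n set \<Rightarrow> real^'n^'m \<Rightarrow> real^'n^'m" where
  "cols S M = (\<chi> i j. if j \<in> S then M $ i $ j else 0)"

definition subvec :: "'n set \<Rightarrow> real^'n \<Rightarrow> real^'n" where
  "subvec S v = (\<chi> j. if j \<in> S then v $ j else 0)"

definition inf_idx :: "ereal^'n \<Rightarrow> 'n set" where
  "inf_idx b = {i. b $ i = \<infinity>}"

definition sym_pos_def :: "real^'n^'n \<Rightarrow> bool" where
  "sym_pos_def A \<longleftrightarrow> transpose A = A \<and> (\<forall>v. v \<noteq> 0 \<longrightarrow> v \<bullet> (A *v v) > 0)"

record ('x::finite, 'm::finite, 'y::finite, 'w::finite) follower =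
  G0 :: "real^'y^'x"
  H0 :: "real^'w^'x"
  h0 :: "real^'x"
  G1 :: "real^'y^'m"
  H1 :: "real^'w^'m"
  h1 :: "real^'m"
  cost_mat :: "real^'y^'y"
  cost_vec :: "real^'y"
  ybar :: "ereal^'y"
  wbar :: "ereal^'w"

definition follower_data :: "('x::finite, 'm::finite, 'y::finite, 'w::finite) follower \<Rightarrow> bool" where
  "follower_data D \<longleftrightarrow> sym_pos_def (cost_mat D) \<and>
     (\<forall>i. ybar D $ i \<noteq> -\<infinity>) \<and> (\<forall>i. wbar D $ i \<noteq> -\<infinity>)"

definition Gmat :: "('x::finite, 'm::finite, 'y::finite, 'w::finite) follower \<Rightarrow> real^'y^('x + 'm)" where
  "Gmat D = vstack (G0 D) (G1 D)"

definition Hmat :: "('x::finite, 'm::finite, 'y::finite, 'w::finite) follower \<Rightarrow> real^'w^('x + 'm)" where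
  "Hmat D = vstack (H0 D) (H1 D)"

definition hvec :: "('x::finite, 'm::finite, 'y::finite, 'w::finite) follower \<Rightarrow> real^('x + 'm)" where
  "hvec D = vstack (h0 D) (h1 D)"

definition cost :: "('x::finite, 'm::finite, 'y::finite, 'w::finite) follower \<Rightarrow> real^'y \<Rightarrow> real^'y" where
  "cost D y = cost_mat D *v y + cost_vec D"

definition follower_feasible ::
  "('x::finite, 'm::finite, 'y::finite, 'w::finite) follower \<Rightarrow> real^'x \<Rightarrow> ((real^'y) \<times> (real^'w)) set" where
  "follower_feasible D x = {(y, w).
     G0 D *v y + H0 D *v w - x = h0 D \<and>
     G1 D *v y + H1 D *v w = h1 D \<and>
     0 \<le> y \<and> (\<forall>i. ereal (y $ i) \<le> ybar D $ i) \<and>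
     0 \<le> w \<and> (\<forall>i. ereal (w $ i) \<le> wbar D $ i)}"

definition follower_solutions ::
  "('x::finite, 'm::finite, 'y::finite, 'w::finite) follower \<Rightarrow> real^'x \<Rightarrow> ((real^'y) \<times> (real^'w)) set" where
  "follower_solutions D x = {(y, w). (y, w) \<in> follower_feasible D x \<and>
     (\<forall>y' \<in> fst ` follower_feasible D x. cost D y \<bullet> (y' - y) \<ge> 0)}"

text \<open>The follower's KKT conditions at \<open>x\<close> without complementarity (the sign of the price
  vector \<open>\<pi>\<close> is not constrained here; it is a constraint of the leader).
  The multipliers \<open>\<theta>y\<close>, \<open>\<theta>w\<close> of the finite upper bounds are stored as full
  vectors that vanish at the infinite bounds.\<close>

definition kkt_relax ::
  "('x::finite, 'm::finite, 'y::finite, 'w::finite) follower \<Rightarrow> real^'x \<Rightarrow> real^'y \<Rightarrow> real^'w \<Rightarrow>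
   real^('x + 'm) \<Rightarrow> real^'y \<Rightarrow> real^'w \<Rightarrow> real^'y \<Rightarrow> real^'w \<Rightarrow> bool" where
  "kkt_relax D x y w \<pi> \<mu>y \<mu>w \<theta>y \<theta>w \<longleftrightarrow>
     (let Iy = inf_idx (ybar D); Iw = inf_idx (wbar D) in
       Gmat D *v y + Hmat D *v w = hvec D + vstack x 0 \<and>
       cost_mat D *v y + transpose (Gmat D) *v \<pi> - \<mu>y + cols (- Iy) (mat 1) *v \<theta>y = - cost_vec D \<and>
       transpose (Hmat D) *v \<pi> - \<mu>w + cols (- Iw) (mat 1) *v \<theta>w = 0 \<and>
       0 \<le> y \<and> 0 \<le> w \<and>
       (\<forall>i \<in> - Iy. ereal (y $ i) \<le> ybar D $ i) \<and>
       (\<forall>i \<in> - Iw. ereal (w $ i) \<le> wbar D $ i) \<and>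
       0 \<le> \<mu>y \<and> 0 \<le> \<mu>w \<and>
       0 \<le> \<theta>y \<and> subvec Iy \<theta>y = 0 \<and>
       0 \<le> \<theta>w \<and> subvec Iw \<theta>w = 0)"

text \<open>A price vector that is feasible for these conditions need not be nonnegative, and there
  may be no nonnegative one even if the follower has a solution at \<open>x\<close>.\<close>

definition kkt_relax_prices ::
  "('x::finite, 'm::finite, 'y::finite, 'w::finite) follower \<Rightarrow> real^'x \<Rightarrow> (real^('x + 'm)) set" where
  "kkt_relax_prices D x = {\<pi>. \<exists>y w \<mu>y \<mu>w \<theta>y \<theta>w. kkt_relax D x y w \<pi> \<mu>y \<mu>w \<theta>y \<theta>w}"

text \<open>The product with \<open>cols (inf_idx (ybar D)) (Gmat D)\<close> is
  \<open>G\<^sub>\<infinity> y\<^sub>\<infinity>\<close>, and similarly for the other blocks; the components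
  omitted from \<open>y\<close>, \<open>w\<close>, \<open>\<theta>y\<close>, \<open>\<theta>w\<close> must be zero, so that they do not
  make an otherwise zero vector nonzero.\<close>

definition kkt_ray ::
  "('x::finite, 'm::finite, 'y::finite, 'w::finite) follower \<Rightarrow> real^'y \<Rightarrow> real^'w \<Rightarrow>
   real^('x + 'm) \<Rightarrow> real^'y \<Rightarrow> real^'w \<Rightarrow> real^'y \<Rightarrow> real^'w \<Rightarrow> bool" where
  "kkt_ray D y w \<pi> \<mu>y \<mu>w \<theta>y \<theta>w \<longleftrightarrow>
     (let Iy = inf_idx (ybar D); Iw = inf_idx (wbar D) in
       (y, w, \<pi>, \<mu>y, \<mu>w, \<theta>y, \<theta>w) \<noteq> 0 \<and>
       0 \<le> y \<and> 0 \<le> w \<and> 0 \<le> \<pi> \<and> 0 \<le> \<mu>y \<and> 0 \<le> \<mu>w \<and> 0 \<le> \<theta>y \<and> 0 \<le> \<theta>w \<and>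
       subvec (- Iy) y = 0 \<and> subvec (- Iw) w = 0 \<and>
       subvec Iy \<theta>y = 0 \<and> subvec Iw \<theta>w = 0 \<and>
       cols Iy (Gmat D) *v subvec Iy y + cols Iw (Hmat D) *v subvec Iw w = 0 \<and>
       cols Iy (cost_mat D) *v subvec Iy y + transpose (Gmat D) *v \<pi> - mat 1 *v \<mu>y
         + cols (- Iy) (mat 1) *v \<theta>y = 0 \<and>
       transpose (Hmat D) *v \<pi> - mat 1 *v \<mu>w + cols (- Iw) (mat 1) *v \<theta>w = 0)"

definition leader_relax_region ::
  "((real^'z) \<times> (real^'x)) set \<Rightarrow> real^'z \<Rightarrow> real^'x \<Rightarrow> ((real^'z) \<times> (real^'x)) set" where
  "leader_relax_region Pbar zbar xbar =
     {(z, x). (z, x) \<in> Pbar \<and> 0 \<le> z \<and> z \<le> zbar \<and> 0 \<le> x \<and> x \<le> xbar}"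

text \<open>The optimal value is an extended real: it is \<open>-\<infinity>\<close> if the problem is infeasible
  and \<open>\<infinity>\<close> iff the objective is unbounded above on the feasible set.\<close>

definition kkt_relax_value ::
  "((real^'z) \<times> (real^'x)) set \<Rightarrow> real^'z \<Rightarrow> real^'x \<Rightarrow> real^'z \<Rightarrow> real^'x \<Rightarrow>
   ('x::finite, 'm::finite, 'y::finite, 'w::finite) follower \<Rightarrow> ereal" where
  "kkt_relax_value Pbar zbar xbar cz cx D =
     Sup {ereal (\<pi>0 \<bullet> x - cx \<bullet> x - cz \<bullet> z) | z x y w \<pi>0 \<pi>1 \<mu>y \<mu>w \<theta>y \<theta>w.
       (z, x) \<in> leader_relax_region Pbar zbar xbar \<and> 0 \<le> \<pi>0 \<and> 0 \<le> \<pi>1 \<and>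
       kkt_relax D x y w (vstack \<pi>0 \<pi>1) \<mu>y \<mu>w \<theta>y \<theta>w}"

end

theory Submission imports Defs begin

text \<open>The follower's problem at \<open>x_dot\<close> has linear constraints, so a solution \<open>(y0, w0)\<close> of it
  carries multipliers (lemma \<open>follower_solution_imp_kkt_relax\<close>). As the variational
  inequality involves the cost vector \<open>cost D y0\<close> at the solution only, this is linear programming
  duality: were there no
  multipliers, Farkas' lemma would give a direction along which one can leave \<open>(y0, w0)\<close> within the
  feasible set while strictly decreasing the linearized cost. By the sign hypothesis, nonnegative
  prices can then be chosen as well, so that the relaxation has a feasible point with
  \<open>z = z_dot\<close> and \<open>x = x_dot\<close>.

  The given ray is a recession direction of the constraints on the remaining variables
  (lemma \<open>kkt_relax_add_ray\<close>): complementarity is absent, and \<open>y\<close>, \<open>w\<close> move only in components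
  without an upper bound. Following it with \<open>(z_dot, x_dot)\<close> held fixed raises the revenue
  \<open>\<pi>0 \<bullet> x_dot\<close> at a constant positive rate, while the leader's costs do not change.\<close>

section \<open>Farkas' lemma\<close>

text \<open>A finitely generated cone is closed, so a point outside it can be strictly separated from it;
  by scaling, the separating functional is nonnegative on the cone.\<close>

lemma farkas:
  fixes S :: "'a::euclidean_space set"
  assumes "finite S" and "c \<notin> convex_cone hull S"
  obtains d where "d \<bullet> c < 0" and "\<And>s. s \<in> S \<Longrightarrow> 0 \<le> d \<bullet> s"
proof -
  let ?K = "convex_cone hull S"
  have "\<exists>d b. d \<bullet> c < b \<and> (\<forall>v\<in>?K. b < d \<bullet> v)"
    by (intro separating_hyperplane_closed_point convex_convex_cone_hull closed_convex_cone_hull assms)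
  then obtain d b where d: "d \<bullet> c < b" "\<And>v. v \<in> ?K \<Longrightarrow> b < d \<bullet> v"
    by blast
  have b: "b < 0"
    using d(2)[OF convex_cone_hull_contains_0] by simp
  have "0 \<le> d \<bullet> s" if "s \<in> S" for s
  proof (rule ccontr)
    assume neg: "\<not> 0 \<le> d \<bullet> s"
    \<comment> \<open>The multiple of \<open>s\<close> on which the functional takes the value \<open>b\<close>.\<close>
    have "(b / (d \<bullet> s)) *\<^sub>R s \<in> ?K"
    proof (rule convex_cone_hull_mul)
      show "s \<in> ?K"
        using that by (rule hull_inc)
      show "0 \<le> b / (d \<bullet> s)"
        using neg b by (simp add: divide_nonpos_neg)
    qed
    from d(2)[OF this] neg show False
      by simp
  qed
  moreover have "d \<bullet> c < 0"
    using d(1) b by (rule less_trans)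
  ultimately show ?thesis
    using that by blast
qed

section \<open>Columns, subvectors and stacked vectors\<close>

lemma cols_mult_vec: "cols S A *v v = A *v subvec S v"
  by (simp add: vec_eq_iff cols_def subvec_def matrix_vector_mult_def if_distrib if_distribR cong: if_cong)

lemma subvec_eq_self_iff: "subvec S v = v \<longleftrightarrow> subvec (- S) v = 0"
  by (auto simp: vec_eq_iff subvec_def)

lemma subvec_eq_0_iff: "subvec S v = 0 \<longleftrightarrow> (\<forall>i\<in>S. v $ i = 0)"
  by (auto simp: vec_eq_iff subvec_def)

lemma vstack_add: "vstack a b + vstack c d = vstack (a + c) (b + d)"
  by (simp add: vec_eq_iff vstack_def split: sum.split)

lemma vstack_scaleR: "t *\<^sub>R vstack a b = vstack (t *\<^sub>R a) (t *\<^sub>R b)"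
  by (simp add: vec_eq_iff vstack_def split: sum.split)

lemma vstack_eq_iff: "vstack a b = vstack c d \<longleftrightarrow> a = c \<and> b = d"
  by (auto simp: vec_eq_iff vstack_def split_sum_all)

lemma zero_le_vstack_iff: "0 \<le> vstack a b \<longleftrightarrow> 0 \<le> a \<and> 0 \<le> b"
  by (auto simp: less_eq_vec_def vstack_def split_sum_all)

lemma vstack_exhaust: obtains a b where "v = vstack a b"
proof
  show "v = vstack (\<chi> i. v $ Inl i) (\<chi> j. v $ Inr j)"
    by (simp add: vec_eq_iff vstack_def split: sum.split)
qed

lemma vstack_mult_vec: "vstack A B *v v = vstack (A *v v) (B *v v)"
  by (simp add: vec_eq_iff vstack_def matrix_vector_mult_def split: sum.split)

lemma zero_le_vec_iff: "0 \<le> v \<longleftrightarrow> (\<forall>i. 0 \<le> v $ i)" for v :: "real^'n"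
  by (simp add: less_eq_vec_def)

lemma zero_le_add_scaleR:
  fixes u v :: "real^'n"
  assumes "0 \<le> u" "0 \<le> v" "0 \<le> t"
  shows "0 \<le> u + t *\<^sub>R v"
  using assms by (simp add: zero_le_vec_iff)

section \<open>Multipliers of a follower solution\<close>

lemma follower_feasible_iff:
  "(y, w) \<in> follower_feasible D x \<longleftrightarrow>
     Gmat D *v y + Hmat D *v w = hvec D + vstack x 0 \<and>
     0 \<le> y \<and> (\<forall>i. ereal (y $ i) \<le> ybar D $ i) \<and>
     0 \<le> w \<and> (\<forall>i. ereal (w $ i) \<le> wbar D $ i)"
  by (auto simp: follower_feasible_def Gmat_def Hmat_def hvec_def vstack_mult_vec vstack_add
      vstack_eq_iff algebra_simps)

text \<open>The right-hand sides for which the stationarity equations of \<open>kkt_relax\<close> are solvable with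
  the prescribed signs, once the terms in \<open>y\<close> have been moved to the right. As a convex cone, it
  contains the cone generated by any finite set of its members, which is what Farkas' lemma needs.\<close>

definition multiplier_cone ::
  "real^'y^'k \<Rightarrow> real^'w^'k \<Rightarrow> 'y set \<Rightarrow> 'w set \<Rightarrow> ((real^'y) \<times> (real^'w)) set" where
  "multiplier_cone G H Iy Iw =
     {(transpose G *v \<pi> - \<mu>y + \<theta>y, transpose H *v \<pi> - \<mu>w + \<theta>w) | \<pi> \<mu>y \<mu>w \<theta>y \<theta>w.
       0 \<le> \<mu>y \<and> 0 \<le> \<mu>w \<and> 0 \<le> \<theta>y \<and> 0 \<le> \<theta>w \<and> subvec Iy \<theta>y = 0 \<and> subvec Iw \<theta>w = 0}"

lemma multiplier_coneI:
  assumes "0 \<le> \<mu>y" "0 \<le> \<mu>w" "0 \<le> \<theta>y" "0 \<le> \<theta>w" "subvec Iy \<theta>y = 0" "subvec Iw \<theta>w = 0"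
    and "v = (transpose G *v \<pi> - \<mu>y + \<theta>y, transpose H *v \<pi> - \<mu>w + \<theta>w)"
  shows "v \<in> multiplier_cone G H Iy Iw"
  using assms unfolding multiplier_cone_def by blast

lemma convex_cone_multiplier_cone: "convex_cone (multiplier_cone G H Iy Iw)"
  unfolding convex_cone_iff
proof (intro conjI ballI allI impI)
  show "0 \<in> multiplier_cone G H Iy Iw"
    by (rule multiplier_coneI[of 0 0 0 0 _ _ _ _ 0]) (auto simp: subvec_eq_0_iff zero_prod_def)
next
  fix u v
  assume "u \<in> multiplier_cone G H Iy Iw" and "v \<in> multiplier_cone G H Iy Iw"
  then obtain \<pi> \<mu>y \<mu>w \<theta>y \<theta>w \<pi>' \<mu>y' \<mu>w' \<theta>y' \<theta>w' where *:
    "u = (transpose G *v \<pi> - \<mu>y + \<theta>y, transpose H *v \<pi> - \<mu>w + \<theta>w)"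
    "v = (transpose G *v \<pi>' - \<mu>y' + \<theta>y', transpose H *v \<pi>' - \<mu>w' + \<theta>w')"
    "0 \<le> \<mu>y" "0 \<le> \<mu>w" "0 \<le> \<theta>y" "0 \<le> \<theta>w" "subvec Iy \<theta>y = 0" "subvec Iw \<theta>w = 0"
    "0 \<le> \<mu>y'" "0 \<le> \<mu>w'" "0 \<le> \<theta>y'" "0 \<le> \<theta>w'" "subvec Iy \<theta>y' = 0" "subvec Iw \<theta>w' = 0"
    unfolding multiplier_cone_def by blast
  show "u + v \<in> multiplier_cone G H Iy Iw"
    by (rule multiplier_coneI[of "\<mu>y + \<mu>y'" "\<mu>w + \<mu>w'" "\<theta>y + \<theta>y'" "\<theta>w + \<theta>w'" _ _ _ _ "\<pi> + \<pi>'"])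
      (use * in \<open>auto simp: subvec_eq_0_iff zero_le_vec_iff matrix_vector_right_distrib\<close>)
next
  fix v and c :: real
  assume "v \<in> multiplier_cone G H Iy Iw" and c: "0 \<le> c"
  then obtain \<pi> \<mu>y \<mu>w \<theta>y \<theta>w where *:
    "v = (transpose G *v \<pi> - \<mu>y + \<theta>y, transpose H *v \<pi> - \<mu>w + \<theta>w)"
    "0 \<le> \<mu>y" "0 \<le> \<mu>w" "0 \<le> \<theta>y" "0 \<le> \<theta>w" "subvec Iy \<theta>y = 0" "subvec Iw \<theta>w = 0"
    unfolding multiplier_cone_def by blast
  show "c *\<^sub>R v \<in> multiplier_cone G H Iy Iw"
    by (rule multiplier_coneI[of "c *\<^sub>R \<mu>y" "c *\<^sub>R \<mu>w" "c *\<^sub>R \<theta>y" "c *\<^sub>R \<theta>w" _ _ _ _ "c *\<^sub>R \<pi>"])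
      (use * c in \<open>auto simp: subvec_eq_0_iff zero_le_vec_iff matrix_vector_mult_scaleR algebra_simps\<close>)
qed

text \<open>The theorem of alternatives for the multipliers. The unit vectors among the generators force
  the direction \<open>(p, q)\<close> to be nonnegative and to vanish at the finite bounds; the signed rows of
  \<open>G\<close> and \<open>H\<close> force it to preserve the equality constraints.\<close>

lemma multiplier_cone_alternative:
  fixes G :: "real^'y^'k" and H :: "real^'w^'k"
  assumes "(a, b) \<notin> multiplier_cone G H Iy Iw"
  obtains p q where "0 \<le> p" "0 \<le> q" "subvec (- Iy) p = 0" "subvec (- Iw) q = 0"
    "G *v p + H *v q = 0" "0 < p \<bullet> a + q \<bullet> b"
proof -
  let ?K = "multiplier_cone G H Iy Iw"
  let ?f = "\<lambda>\<pi>. (transpose G *v \<pi>, transpose H *v \<pi>)"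
  define S where "S = range (\<lambda>k. ?f (axis k 1)) \<union> range (\<lambda>k. ?f (axis k (-1)))
    \<union> range (\<lambda>i. (axis i (-1) :: real^'y, 0 :: real^'w)) \<union> range (\<lambda>j. (0, axis j (-1)))
    \<union> (\<lambda>i. (axis i 1, 0)) ` (- Iy) \<union> (\<lambda>j. (0, axis j 1)) ` (- Iw)"
  have "S \<subseteq> ?K"
  proof -
    have "?f \<pi> \<in> ?K" for \<pi>
      by (rule multiplier_coneI[of 0 0 0 0 _ _ _ _ \<pi>]) (auto simp: subvec_eq_0_iff)
    moreover have "(axis i (-1), 0) \<in> ?K" for i
      by (rule multiplier_coneI[of "axis i 1" 0 0 0 _ _ _ _ 0])
        (auto simp: subvec_def zero_le_vec_iff axis_def vec_eq_iff)
    moreover have "(0, axis j (-1)) \<in> ?K" for j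
      by (rule multiplier_coneI[of 0 "axis j 1" 0 0 _ _ _ _ 0])
        (auto simp: subvec_def zero_le_vec_iff axis_def vec_eq_iff)
    moreover have "(axis i 1, 0) \<in> ?K" if "i \<in> - Iy" for i
      by (rule multiplier_coneI[of 0 0 "axis i 1" 0 _ _ _ _ 0])
        (use that in \<open>auto simp: subvec_def zero_le_vec_iff axis_def vec_eq_iff\<close>)
    moreover have "(0, axis j 1) \<in> ?K" if "j \<in> - Iw" for j
      by (rule multiplier_coneI[of 0 0 0 "axis j 1" _ _ _ _ 0])
        (use that in \<open>auto simp: subvec_def zero_le_vec_iff axis_def vec_eq_iff\<close>)
    ultimately show ?thesis
      unfolding S_def by blast
  qed
  then have "convex_cone hull S \<subseteq> ?K"
    by (intro hull_minimal convex_cone_multiplier_cone)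
  then have outside: "(a, b) \<notin> convex_cone hull S"
    using assms by blast
  have "finite S"
    unfolding S_def by simp
  from farkas[OF this outside] obtain d where d: "d \<bullet> (a, b) < 0" "\<And>s. s \<in> S \<Longrightarrow> 0 \<le> d \<bullet> s"
    by blast
  obtain p q where pq: "d = (- p, - q)"
    by (metis add.inverse_inverse surj_pair)
  have p_nonneg: "0 \<le> p $ i" for i
  proof -
    have "(axis i (-1), 0) \<in> S"
      unfolding S_def by blast
    from d(2)[OF this] show ?thesis
      by (simp add: pq inner_axis)
  qed
  have q_nonneg: "0 \<le> q $ j" for j
  proof -
    have "(0, axis j (-1)) \<in> S"
      unfolding S_def by blast
    from d(2)[OF this] show ?thesis
      by (simp add: pq inner_axis)
  qed
  have p_fin: "p $ i = 0" if "i \<in> - Iy" for i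
  proof -
    have "(axis i 1, 0) \<in> S"
      using that unfolding S_def by blast
    from d(2)[OF this] p_nonneg[of i] show ?thesis
      by (simp add: pq inner_axis)
  qed
  have q_fin: "q $ j = 0" if "j \<in> - Iw" for j
  proof -
    have "(0, axis j 1) \<in> S"
      using that unfolding S_def by blast
    from d(2)[OF this] q_nonneg[of j] show ?thesis
      by (simp add: pq inner_axis)
  qed
  have f: "d \<bullet> ?f (axis k c) = - c * (G *v p + H *v q) $ k" for k c
  proof -
    have "p \<bullet> (transpose G *v axis k c) = c * (G *v p) $ k"
      by (simp add: inner_commute[of p] dot_lmul_matrix inner_axis')
    moreover have "q \<bullet> (transpose H *v axis k c) = c * (H *v q) $ k"
      by (simp add: inner_commute[of q] dot_lmul_matrix inner_axis')
    ultimately show ?thesis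
      unfolding pq by (simp only: inner_Pair inner_minus_left vector_add_component ring_distribs)
  qed
  have "(G *v p + H *v q) $ k = 0" for k
  proof -
    have "?f (axis k 1) \<in> S" "?f (axis k (-1)) \<in> S"
      unfolding S_def by blast+
    from this[THEN d(2)] show ?thesis
      unfolding f by simp
  qed
  then have "G *v p + H *v q = 0"
    by (simp add: vec_eq_iff)
  moreover have "0 < p \<bullet> a + q \<bullet> b"
    using d(1) by (simp add: pq)
  ultimately show ?thesis
    using that[of p q] p_nonneg q_nonneg p_fin q_fin
    by (simp add: subvec_eq_0_iff zero_le_vec_iff)
qed

text \<open>Only stationarity has to be shown. A direction \<open>(p, q)\<close> of the alternative leads from the
  solution \<open>(y, w)\<close> to another feasible point, as it moves only components without upper bound, and
  \<open>cost D y \<bullet> p < 0\<close> contradicts the variational inequality at \<open>y + p\<close>.\<close>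

lemma follower_solution_imp_kkt_relax:
  assumes sol: "(y, w) \<in> follower_solutions D x"
  obtains \<pi> \<mu>y \<mu>w \<theta>y \<theta>w where "kkt_relax D x y w \<pi> \<mu>y \<mu>w \<theta>y \<theta>w"
proof -
  define Iy Iw where "Iy = inf_idx (ybar D)" and "Iw = inf_idx (wbar D)"
  have feas: "(y, w) \<in> follower_feasible D x"
    and vi: "\<And>y' w'. (y', w') \<in> follower_feasible D x \<Longrightarrow> 0 \<le> cost D y \<bullet> (y' - y)"
    using sol by (force simp: follower_solutions_def)+
  have "(- cost D y, 0) \<in> multiplier_cone (Gmat D) (Hmat D) Iy Iw"
  proof (rule ccontr)
    assume "\<not> ?thesis"
    then obtain p q where pq: "0 \<le> p" "0 \<le> q" "subvec (- Iy) p = 0" "subvec (- Iw) q = 0"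
      and eq: "Gmat D *v p + Hmat D *v q = 0" and descent: "0 < p \<bullet> (- cost D y) + q \<bullet> 0"
      by (rule multiplier_cone_alternative)
    have "ereal ((y + p) $ i) \<le> ybar D $ i" for i
      using feas pq(3) by (cases "i \<in> Iy") (auto simp: follower_feasible_iff subvec_eq_0_iff Iy_def inf_idx_def)
    moreover have "ereal ((w + q) $ j) \<le> wbar D $ j" for j
      using feas pq(4) by (cases "j \<in> Iw") (auto simp: follower_feasible_iff subvec_eq_0_iff Iw_def inf_idx_def)
    moreover have "Gmat D *v (y + p) + Hmat D *v (w + q) = hvec D + vstack x 0"
    proof -
      have "Gmat D *v (y + p) + Hmat D *v (w + q)
          = (Gmat D *v y + Hmat D *v w) + (Gmat D *v p + Hmat D *v q)"
        by (simp add: matrix_vector_right_distrib algebra_simps)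
      then show ?thesis
        using feas eq by (simp add: follower_feasible_iff)
    qed
    ultimately have "(y + p, w + q) \<in> follower_feasible D x"
      using feas pq(1,2) by (simp add: follower_feasible_iff zero_le_vec_iff)
    from vi[OF this] descent show False
      by (simp add: inner_commute)
  qed
  then obtain \<pi> \<mu>y \<mu>w \<theta>y \<theta>w where
    stat: "- cost D y = transpose (Gmat D) *v \<pi> - \<mu>y + \<theta>y"
      "0 = transpose (Hmat D) *v \<pi> - \<mu>w + \<theta>w"
    and signs: "0 \<le> \<mu>y" "0 \<le> \<mu>w" "0 \<le> \<theta>y" "0 \<le> \<theta>w"
    and \<theta>: "subvec Iy \<theta>y = 0" "subvec Iw \<theta>w = 0"
    unfolding multiplier_cone_def by blast
  have cols: "cols (- Iy) (mat 1) *v \<theta>y = \<theta>y" "cols (- Iw) (mat 1) *v \<theta>w = \<theta>w"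
    using \<theta> subvec_eq_self_iff[of "- Iy" \<theta>y] subvec_eq_self_iff[of "- Iw" \<theta>w]
    by (simp_all add: cols_mult_vec)
  have "cost_mat D *v y + transpose (Gmat D) *v \<pi> - \<mu>y + \<theta>y = - cost_vec D"
    using stat(1) by (simp add: cost_def algebra_simps)
  then have "kkt_relax D x y w \<pi> \<mu>y \<mu>w \<theta>y \<theta>w"
    unfolding kkt_relax_def Let_def Iy_def[symmetric] Iw_def[symmetric] cols
    using feas stat(2) signs \<theta> by (simp add: follower_feasible_iff)
  then show ?thesis
    by (rule that)
qed

section \<open>Moving along a ray\<close>

text \<open>As \<open>y\<close> vanishes at the finite bounds, the submatrices in the ray condition act on it like the
  full matrices do.\<close>

lemma kkt_ray_full:
  assumes "kkt_ray D y w \<pi> \<mu>y \<mu>w \<theta>y \<theta>w"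
  shows "Gmat D *v y + Hmat D *v w = 0"
    and "cost_mat D *v y + transpose (Gmat D) *v \<pi> - \<mu>y
         + cols (- inf_idx (ybar D)) (mat 1) *v \<theta>y = 0"
    and "transpose (Hmat D) *v \<pi> - \<mu>w + cols (- inf_idx (wbar D)) (mat 1) *v \<theta>w = 0"
proof -
  have "subvec (inf_idx (ybar D)) y = y" "subvec (inf_idx (wbar D)) w = w"
    using assms by (simp_all add: kkt_ray_def Let_def subvec_eq_self_iff)
  then show "Gmat D *v y + Hmat D *v w = 0"
    and "cost_mat D *v y + transpose (Gmat D) *v \<pi> - \<mu>y
         + cols (- inf_idx (ybar D)) (mat 1) *v \<theta>y = 0"
    and "transpose (Hmat D) *v \<pi> - \<mu>w + cols (- inf_idx (wbar D)) (mat 1) *v \<theta>w = 0"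
    using assms by (simp_all add: kkt_ray_def Let_def cols_mult_vec)
qed

lemma kkt_relax_add_ray:
  assumes base: "kkt_relax D x y w \<pi> \<mu>y \<mu>w \<theta>y \<theta>w"
    and ray: "kkt_ray D y' w' \<pi>' \<mu>y' \<mu>w' \<theta>y' \<theta>w'"
    and t: "0 \<le> t"
  shows "kkt_relax D x (y + t *\<^sub>R y') (w + t *\<^sub>R w') (\<pi> + t *\<^sub>R \<pi>') (\<mu>y + t *\<^sub>R \<mu>y')
           (\<mu>w + t *\<^sub>R \<mu>w') (\<theta>y + t *\<^sub>R \<theta>y') (\<theta>w + t *\<^sub>R \<theta>w')"
proof -
  define Iy Iw where "Iy = inf_idx (ybar D)" and "Iw = inf_idx (wbar D)"
  note b = base[unfolded kkt_relax_def Let_def, folded Iy_def Iw_def]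
  note r = ray[unfolded kkt_ray_def Let_def, folded Iy_def Iw_def]
  note full = kkt_ray_full[OF ray, folded Iy_def Iw_def]
  note distrib = matrix_vector_right_distrib matrix_vector_mult_scaleR
  have "Gmat D *v (y + t *\<^sub>R y') + Hmat D *v (w + t *\<^sub>R w')
      = (Gmat D *v y + Hmat D *v w) + t *\<^sub>R (Gmat D *v y' + Hmat D *v w')"
    by (simp add: distrib algebra_simps)
  then have primal: "Gmat D *v (y + t *\<^sub>R y') + Hmat D *v (w + t *\<^sub>R w') = hvec D + vstack x 0"
    using b full(1) by simp
  have "cost_mat D *v (y + t *\<^sub>R y') + transpose (Gmat D) *v (\<pi> + t *\<^sub>R \<pi>') - (\<mu>y + t *\<^sub>R \<mu>y')
        + cols (- Iy) (mat 1) *v (\<theta>y + t *\<^sub>R \<theta>y')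
      = (cost_mat D *v y + transpose (Gmat D) *v \<pi> - \<mu>y + cols (- Iy) (mat 1) *v \<theta>y)
        + t *\<^sub>R (cost_mat D *v y' + transpose (Gmat D) *v \<pi>' - \<mu>y' + cols (- Iy) (mat 1) *v \<theta>y')"
    by (simp only: distrib scaleR_add_right scaleR_diff_right) (simp add: algebra_simps)
  then have stat_y: "cost_mat D *v (y + t *\<^sub>R y') + transpose (Gmat D) *v (\<pi> + t *\<^sub>R \<pi>')
      - (\<mu>y + t *\<^sub>R \<mu>y') + cols (- Iy) (mat 1) *v (\<theta>y + t *\<^sub>R \<theta>y') = - cost_vec D"
    using b by (simp only: full(2) scaleR_zero_right add_0_right)
  have "transpose (Hmat D) *v (\<pi> + t *\<^sub>R \<pi>') - (\<mu>w + t *\<^sub>R \<mu>w')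
        + cols (- Iw) (mat 1) *v (\<theta>w + t *\<^sub>R \<theta>w')
      = (transpose (Hmat D) *v \<pi> - \<mu>w + cols (- Iw) (mat 1) *v \<theta>w)
        + t *\<^sub>R (transpose (Hmat D) *v \<pi>' - \<mu>w' + cols (- Iw) (mat 1) *v \<theta>w')"
    by (simp only: distrib scaleR_add_right scaleR_diff_right) (simp add: algebra_simps)
  then have stat_w: "transpose (Hmat D) *v (\<pi> + t *\<^sub>R \<pi>') - (\<mu>w + t *\<^sub>R \<mu>w')
      + cols (- Iw) (mat 1) *v (\<theta>w + t *\<^sub>R \<theta>w') = 0"
    using b by (simp only: full(3) scaleR_zero_right add_0_right)
  have bounds: "\<forall>i\<in>- Iy. ereal ((y + t *\<^sub>R y') $ i) \<le> ybar D $ i"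
    "\<forall>i\<in>- Iw. ereal ((w + t *\<^sub>R w') $ i) \<le> wbar D $ i"
    using b r by (auto simp: subvec_eq_0_iff)
  have supp: "subvec Iy (\<theta>y + t *\<^sub>R \<theta>y') = 0" "subvec Iw (\<theta>w + t *\<^sub>R \<theta>w') = 0"
    using b r by (auto simp: subvec_eq_0_iff)
  show ?thesis
    unfolding kkt_relax_def Let_def Iy_def[symmetric] Iw_def[symmetric]
    using primal stat_y stat_w bounds supp b r t by (simp add: zero_le_add_scaleR)
qed

section \<open>Unboundedness of the relaxation\<close>

theorem lemma3:
  fixes D :: "('x::finite, 'm::finite, 'y::finite, 'w::finite) follower"
    and Pbar :: "((real^'z) \<times> (real^'x)) set"
    and zbar cz z_dot :: "real^'z"
    and xbar cx x_dot \<pi>0 :: "real^'x"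
    and \<pi>1 :: "real^'m"
    and y \<mu>y \<theta>y :: "real^'y"
    and w \<mu>w \<theta>w :: "real^'w"
  assumes "closed Pbar" and "convex Pbar"
    and "follower_data D"
    and dot: "(z_dot, x_dot) \<in> leader_relax_region Pbar zbar xbar"
    and standing: "follower_solutions D x_dot \<noteq> {}"
    and price_sign: "kkt_relax_prices D x_dot \<noteq> {} \<Longrightarrow> \<exists>\<pi> \<in> kkt_relax_prices D x_dot. 0 \<le> \<pi>"
    and ray: "kkt_ray D y w (vstack \<pi>0 \<pi>1) \<mu>y \<mu>w \<theta>y \<theta>w"
    and pos: "\<pi>0 \<bullet> x_dot > 0"
  shows "kkt_relax_value Pbar zbar xbar cz cx D = \<infinity>"
proof -
  obtain y0' w0' where "(y0', w0') \<in> follower_solutions D x_dot"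
    using standing by auto
  then have "kkt_relax_prices D x_dot \<noteq> {}"
    by (rule follower_solution_imp_kkt_relax) (unfold kkt_relax_prices_def, blast)
  then obtain \<pi>' where "0 \<le> \<pi>'" "\<pi>' \<in> kkt_relax_prices D x_dot"
    using price_sign by blast
  moreover obtain p0 p1 where "\<pi>' = vstack p0 p1"
    by (rule vstack_exhaust)
  ultimately obtain y0 w0 \<mu>y0 \<mu>w0 \<theta>y0 \<theta>w0
    where base: "kkt_relax D x_dot y0 w0 (vstack p0 p1) \<mu>y0 \<mu>w0 \<theta>y0 \<theta>w0"
      and p: "0 \<le> p0" "0 \<le> p1"
    by (auto simp: kkt_relax_prices_def zero_le_vstack_iff)
  have \<pi>: "0 \<le> \<pi>0" "0 \<le> \<pi>1"
    using ray by (simp_all add: kkt_ray_def Let_def zero_le_vstack_iff)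
  define a where "a = p0 \<bullet> x_dot - cx \<bullet> x_dot - cz \<bullet> z_dot"
  have reach: "ereal (a + t * (\<pi>0 \<bullet> x_dot)) \<le> kkt_relax_value Pbar zbar xbar cz cx D"
    if t: "0 \<le> t" for t
  proof -
    have kkt: "kkt_relax D x_dot (y0 + t *\<^sub>R y) (w0 + t *\<^sub>R w)
        (vstack (p0 + t *\<^sub>R \<pi>0) (p1 + t *\<^sub>R \<pi>1)) (\<mu>y0 + t *\<^sub>R \<mu>y) (\<mu>w0 + t *\<^sub>R \<mu>w)
        (\<theta>y0 + t *\<^sub>R \<theta>y) (\<theta>w0 + t *\<^sub>R \<theta>w)"
      using kkt_relax_add_ray[OF base ray t] by (simp add: vstack_scaleR vstack_add)
    have "a + t * (\<pi>0 \<bullet> x_dot) = (p0 + t *\<^sub>R \<pi>0) \<bullet> x_dot - cx \<bullet> x_dot - cz \<bullet> z_dot"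
      by (simp add: a_def inner_add_left)
    moreover have "0 \<le> p0 + t *\<^sub>R \<pi>0" "0 \<le> p1 + t *\<^sub>R \<pi>1"
      using p \<pi> t by (auto intro: zero_le_add_scaleR)
    ultimately show ?thesis
      unfolding kkt_relax_value_def using dot kkt by (intro Sup_upper) blast
  qed
  show ?thesis
  proof (rule ereal_top)
    fix B :: real
    \<comment> \<open>The step at which the objective reaches \<open>B\<close>, or \<open>0\<close> if it starts above \<open>B\<close>.\<close>
    define t where "t = max 0 ((B - a) / (\<pi>0 \<bullet> x_dot))"
    have "(B - a) / (\<pi>0 \<bullet> x_dot) \<le> t"
      by (simp add: t_def)
    then have "B \<le> a + t * (\<pi>0 \<bullet> x_dot)"
      using pos by (simp add: field_simps)
    then have "ereal B \<le> ereal (a + t * (\<pi>0 \<bullet> x_dot))"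
      by simp
    also have "\<dots> \<le> kkt_relax_value Pbar zbar xbar cz cx D"
      by (rule reach) (simp add: t_def)
    finally show "ereal B \<le> kkt_relax_value Pbar zbar xbar cz cx D" .
  qed
qed

end
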